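(* Let $(S,+,\cdot,0,1)$ be a dually atomic bounded distributive lattice in which $\mathrm{DAtom}(S)$ is nonempty. If the graph $G(S)$ has no isolated vertex, then $G(S)$ is connected with $\mathrm{diam}(G(S))\le 4$.
   Context: In the lattice $(S,+,\cdot,0,1)$, $+$ denotes join, $\cdot$ denotes meet, $0$ is the least and $1$ the greatest element. The graph $G(S)$ is the simple graph with vertex set $S\setminus\{0,1\}$ in which two vertices $x,y$ are adjacent iff $x\ne y$ and $x\cdot y\neq 0$. A dual atom of $S$ is an element $d$ with $0<d<1$ such that $d\le y\le 1$ implies $y=d$ or $y=1$; $\mathrm{DAtom}(S)$ is the set of dual atoms. The bounded lattice $S$ is dually atomic if for every $x\in S\setminus\{1\}$ there exists a dual atom $m$ with $x\le m$. The diameter of a graph is the greatest distance between any two of its vertices. *)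

theory Defs
  imports "Graph_Theory.Graph_Theory"
begin

definition DAtom :: "'a::bounded_lattice set" where
  "DAtom = {d. bot < d \<and> d < top \<and> (\<forall>y. d \<le> y \<and> y \<le> top \<longrightarrow> y = d \<or> y = top)}"

text \<open>Following \<^theory>\<open>Graph_Theory.Digraph\<close>, an undirected simple graph is represented as a
  symmetric loop-free digraph whose arcs are pairs of vertices; each edge yields two opposite arcs.
  Neither the vertex set nor the arc set has to be finite.\<close>

definition lattice_graph :: "'a::bounded_lattice pair_pre_digraph" where
  "lattice_graph = \<lparr> pverts = UNIV - {bot, top},
     parcs = {(x, y). x \<in> UNIV - {bot, top} \<and> y \<in> UNIV - {bot, top} \<and>
                      x \<noteq> y \<and> inf x y \<noteq> bot} \<rparr>"

lemma pair_bidirected_lattice_graph: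
  "pair_bidirected_digraph (lattice_graph :: 'a::bounded_lattice pair_pre_digraph)"
  by unfold_locales
    (auto simp: lattice_graph_def symmetric_def sym_def inf_commute)

lemma wf_lattice_graph:
  "wf_digraph (with_proj (lattice_graph :: 'a::bounded_lattice pair_pre_digraph))"
  by unfold_locales (auto simp: lattice_graph_def)

definition isolated_vertex :: "('v, 'e) pre_digraph \<Rightarrow> 'v \<Rightarrow> bool" where
  "isolated_vertex G v \<longleftrightarrow> v \<in> verts G \<and> in_arcs G v = {} \<and> out_arcs G v = {}"

text \<open>With unit arc weights \<^const>\<open>wf_digraph.\<mu>\<close> is the length of a shortest walk, and \<open>\<infinity>\<close> if there
  is none. The supremum is \<open>\<infinity>\<close> exactly if the distances are unbounded or some
  distance is infinite; otherwise, in a graph with at least one vertex, it is a maximum.\<close>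

definition diameter :: "('v, 'e) pre_digraph \<Rightarrow> ereal" where
  "diameter G = (SUP (u, v) \<in> verts G \<times> verts G. wf_digraph.\<mu> G (\<lambda>_. 1) u v)"

end

theory Submission
  imports Defs
begin

text \<open>Every vertex lies below a dual atom, so it suffices that two distinct dual atoms \<open>m\<close> and \<open>n\<close>
  have nonzero meet: then \<open>x, m, n, y\<close> (with repetitions dropped) is a walk between vertices
  \<open>x \<le> m\<close> and \<open>y \<le> n\<close>. If the meet were \<open>0\<close>, then a neighbour \<open>p\<close> of \<open>m\<close> could be neither below \<open>n\<close>,
  as it meets \<open>m\<close>, nor joined with \<open>n\<close> to \<open>1\<close>, as \<open>m = m(p + n) = mp\<close> would force \<open>m \<le> p\<close>. So \<open>m\<close>
  would be isolated. In fact this bounds the diameter by 3.\<close>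

lemma DAtom_neq_bot: "m \<in> DAtom \<Longrightarrow> m \<noteq> bot"
  and DAtom_neq_top: "m \<in> DAtom \<Longrightarrow> m \<noteq> top"
  by (auto simp: DAtom_def)

lemma DAtom_le_cases:
  assumes "m \<in> DAtom" "m \<le> y"
  obtains "y = m" | "y = top"
  using assms by (auto simp: DAtom_def)

text \<open>The arc set is symmetric, so an incoming arc also yields a neighbour. That
  \<open>p\<close> is not \<open>bot\<close> follows from
  \<open>inf v p \<noteq> bot\<close>.\<close>

lemma lattice_graph_neighbour:
  fixes v :: "'a::bounded_lattice"
  assumes "\<not> isolated_vertex (with_proj (lattice_graph :: 'a pair_pre_digraph)) v"
    and "v \<noteq> bot" "v \<noteq> top"
  obtains p where "p \<noteq> v" "p \<noteq> top" "inf v p \<noteq> bot"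
  using assms
  by (fastforce simp: isolated_vertex_def lattice_graph_def in_arcs_def out_arcs_def inf_commute)

lemma DAtom_inf_neq_bot:
  fixes m n :: "'a::{distrib_lattice, bounded_lattice}"
  assumes "m \<in> DAtom" "n \<in> DAtom"
    and "\<not> isolated_vertex (with_proj (lattice_graph :: 'a pair_pre_digraph)) m"
  shows "inf m n \<noteq> bot"
proof
  assume disj: "inf m n = bot"
  obtain p where p: "p \<noteq> m" "p \<noteq> top" "inf m p \<noteq> bot"
    using lattice_graph_neighbour assms(1,3) DAtom_neq_bot DAtom_neq_top by metis
  \<comment> \<open>Distributivity enters here: the part \<open>inf m n\<close> of the expanded meet
    vanishes.\<close>
  have distr: "inf m (sup p n) = inf m p"
    by (simp add: inf_sup_distrib1 disj)
  from \<open>n \<in> DAtom\<close> sup_ge2 show False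
  proof (rule DAtom_le_cases)
    assume "sup p n = n"
    \<comment> \<open>In this case \<open>distr\<close> reads \<open>inf m n = inf m p\<close>, and
      only the left side is \<open>bot\<close>.\<close>
    with distr disj p(3) show False by simp
  next
    assume "sup p n = top"
    with distr have "m \<le> p" by (simp add: inf.absorb_iff1)
    with \<open>m \<in> DAtom\<close> p(1,2) show False by (blast elim: DAtom_le_cases)
  qed
qed

interpretation lattice_graph:
  wf_digraph "with_proj (lattice_graph :: 'a::bounded_lattice pair_pre_digraph)"
  by (rule wf_lattice_graph)

lemma verts_lattice_graph: "pverts lattice_graph = UNIV - {bot, top}"
  by (simp add: lattice_graph_def)

text \<open>The graph has no loops, so \<open>x = y\<close> calls for the empty walk. Allowing it
  spares a case distinction on coinciding vertices when walks are concatenated. The nonzero meet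
  also keeps \<open>x\<close> and \<open>y\<close> away from \<open>bot\<close>.\<close>

lemma lattice_graph_short_awalk:
  assumes "x \<noteq> top" "y \<noteq> top" "inf x y \<noteq> bot"
  obtains p where "lattice_graph.awalk x p y" "length p \<le> 1"
proof (cases "x = y")
  case True
  with assms have "lattice_graph.awalk x [] y"
    by (simp add: lattice_graph.awalk_Nil_iff verts_lattice_graph)
  then show ?thesis using that by simp
next
  case False
  with assms have "(x, y) \<in> parcs lattice_graph"
    by (auto simp: lattice_graph_def)
  then have "lattice_graph.awalk x [(x, y)] y"
    using lattice_graph.arc_implies_awalk by fastforce
  then show ?thesis using that by simp
qed

lemma lattice_graph_awalk_le_3:
  fixes x y :: "'a::{distrib_lattice, bounded_lattice}"
  assumes below: "\<forall>x :: 'a. x \<noteq> top \<longrightarrow> (\<exists>m \<in> DAtom. x \<le> m)"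
    and no_isolated: "\<not> (\<exists>v. isolated_vertex (with_proj (lattice_graph :: 'a pair_pre_digraph)) v)"
    and "x \<in> pverts lattice_graph" "y \<in> pverts lattice_graph"
  obtains p where "lattice_graph.awalk x p y" "length p \<le> 3"
proof -
  have xy: "x \<noteq> bot" "x \<noteq> top" "y \<noteq> bot" "y \<noteq> top"
    using assms(3,4) by (auto simp: verts_lattice_graph)
  obtain m n where m: "m \<in> DAtom" "x \<le> m" and n: "n \<in> DAtom" "y \<le> n"
    using below xy by metis
  have "inf x m \<noteq> bot" "inf n y \<noteq> bot"
    using xy m n by (simp_all add: inf.absorb1 inf.absorb2)
  moreover have "inf m n \<noteq> bot"
    using DAtom_inf_neq_bot m n no_isolated by blast
  ultimately obtain p q r where
    "lattice_graph.awalk x p m" "lattice_graph.awalk m q n" "lattice_graph.awalk n r y"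
    "length p \<le> 1" "length q \<le> 1" "length r \<le> 1"
    using lattice_graph_short_awalk DAtom_neq_top m(1) n(1) xy by metis
  then show ?thesis
    using that[of "p @ q @ r"] by (auto intro: lattice_graph.awalk_appendI)
qed

theorem theorem3p4:
  assumes "\<forall>x :: 'a :: {distrib_lattice, bounded_lattice}. x \<noteq> top \<longrightarrow> (\<exists>m \<in> DAtom. x \<le> m)"
    and "(DAtom :: 'a set) \<noteq> {}"
    and "\<not> (\<exists>v. isolated_vertex (with_proj (lattice_graph :: 'a pair_pre_digraph)) v)"
  shows "Digraph_Component.connected (with_proj (lattice_graph :: 'a pair_pre_digraph)) \<and>
    diameter (with_proj (lattice_graph :: 'a pair_pre_digraph)) \<le> 4"
proof
  note walk = lattice_graph_awalk_le_3[OF assms(1,3)]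
  \<comment> \<open>Connectedness includes having a vertex; any dual atom is one.\<close>
  have "pverts (lattice_graph :: 'a pair_pre_digraph) \<noteq> {}"
    using assms(2) DAtom_neq_bot DAtom_neq_top by (auto simp: verts_lattice_graph)
  \<comment> \<open>Connectedness of a digraph means strong connectedness of its symmetric closure,
    so reachability is transferred there.\<close>
  moreover have "u \<rightarrow>\<^sup>*\<^bsub>with_proj (mk_symmetric (with_proj lattice_graph))\<^esub> v"
    if "u \<in> pverts lattice_graph" "v \<in> pverts lattice_graph" for u v :: 'a
    using that walk lattice_graph.reachable_awalkI lattice_graph.reachable_mk_symmetricI by metis
  ultimately show "Digraph_Component.connected (with_proj (lattice_graph :: 'a pair_pre_digraph))"
    by (simp add: Digraph_Component.connected_def strongly_connected_def)
  have "lattice_graph.\<mu> (\<lambda>_. 1) u v \<le> 4"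
    if uv: "u \<in> pverts lattice_graph" "v \<in> pverts lattice_graph" for u v :: 'a
  proof -
    obtain p where p: "lattice_graph.awalk u p v" "length p \<le> 3"
      using walk[OF uv] .
    \<comment> \<open>Any walk bounds the distance from above, and with unit weights its cost is its
      length.\<close>
    have "lattice_graph.\<mu> (\<lambda>_. 1) u v \<le> lattice_graph.awalk_cost (\<lambda>_. 1) p"
      using p(1) by (rule lattice_graph.min_cost_le_walk_cost)
    also have "\<dots> = length p"
      by (simp add: lattice_graph.awalk_cost_def sum_list_triv)
    also have "\<dots> \<le> 4"
      using p(2) by simp
    finally show ?thesis .
  qed
  then show "diameter (with_proj (lattice_graph :: 'a pair_pre_digraph)) \<le> 4"
    by (auto simp: diameter_def intro!: SUP_least)
qed

end
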